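(* Let $n\ge 3$. Every $n\times n$ dissimilarity matrix has star tree rank at most $n-2$, and this bound is sharp: the dissimilarity matrix $M$ defined by $M_{ij}=\min\{i,j\}$ for $i\ne j$ has star tree rank $n-2$.
   Context: An $n\times n$ dissimilarity matrix is a function $\{\{i,j\}: i\ne j\in[n]\}\to\mathbb{R}$, written as a symmetric matrix without diagonal entries. A star tree matrix is a dissimilarity matrix of the form $(v_i+v_j)_{i\ne j}$ for some $v\in\mathbb{R}^n$. The star tree rank of a dissimilarity matrix $M$ is the smallest $r$ such that $M$ is the entrywise minimum of $r$ star tree matrices. *)

theory Defs
  imports Complex_Main "HOL-Library.Extended_Nat"
begin

text \<open>
  An \<open>n \<times> n\<close> matrix is a function \<open>nat \<Rightarrow> nat \<Rightarrow> real\<close> of which only the entries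
  at distinct indices from \<open>{1..n}\<close> matter: diagonal and out-of-range values are ignored
  by all the definitions below, and likewise for the vectors \<open>nat \<Rightarrow> real\<close>.
\<close>

definition dissimilarity_matrix :: "nat \<Rightarrow> (nat \<Rightarrow> nat \<Rightarrow> real) \<Rightarrow> bool" where
  "dissimilarity_matrix n M \<longleftrightarrow> (\<forall>i\<in>{1..n}. \<forall>j\<in>{1..n}. i \<noteq> j \<longrightarrow> M i j = M j i)"

definition star_tree_matrix :: "nat \<Rightarrow> (nat \<Rightarrow> nat \<Rightarrow> real) \<Rightarrow> bool" where
  "star_tree_matrix n S \<longleftrightarrow> dissimilarity_matrix n S \<and>
     (\<exists>v :: nat \<Rightarrow> real. \<forall>i\<in>{1..n}. \<forall>j\<in>{1..n}. i \<noteq> j \<longrightarrow> S i j = v i + v j)"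

text \<open>
  The condition \<open>r \<ge> 1\<close> is needed because \<open>Min {}\<close> is an unspecified real number.
\<close>

definition is_min_of_star_trees :: "nat \<Rightarrow> (nat \<Rightarrow> nat \<Rightarrow> real) \<Rightarrow> nat \<Rightarrow> bool" where
  "is_min_of_star_trees n M r \<longleftrightarrow> r \<ge> 1 \<and>
     (\<exists>S :: nat \<Rightarrow> nat \<Rightarrow> nat \<Rightarrow> real.
        (\<forall>k<r. star_tree_matrix n (S k)) \<and>
        (\<forall>i\<in>{1..n}. \<forall>j\<in>{1..n}. i \<noteq> j \<longrightarrow> M i j = Min ((\<lambda>k. S k i j) ` {..<r})))"

text \<open>
  The rank is \<open>\<infinity>\<close> if there is no such \<open>r\<close>, so a finite upper bound on it includes the
  existence of a decomposition.
\<close>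

definition star_tree_rank :: "nat \<Rightarrow> (nat \<Rightarrow> nat \<Rightarrow> real) \<Rightarrow> enat" where
  "star_tree_rank n M = Inf {enat r |r. is_min_of_star_trees n M r}"

end

theory Submission
  imports Defs "HOL-Library.Multiset"
begin

text \<open>
  For the lower bound, colour each pair \<open>a < b\<close> by a star tree attaining \<open>M\<^sub>a\<^sub>b = a\<close>. If disjoint
  pairs \<open>{a, b}\<close> and \<open>{a', b'}\<close> have overlapping intervals and the same star \<open>v\<close>, then
  \<open>a + a' = (v\<^sub>a + v\<^sub>a') + (v\<^sub>b + v\<^sub>b') \<ge> min a a' + min b b' > a + a'\<close>, which is absurd. So the
  stars properly colour a Kneser-type graph, namely the 2-subsets of \<open>{1, \<dots>, n}\<close> with disjoint sets
  adjacent when their intervals overlap. As for Kneser graphs, the octahedral Tucker lemma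
  (proved here by Ky Fan's parity argument) shows that this needs \<open>n - 2\<close> colours: a sign vector
  is labelled by the colour of the extreme pair of one sign class having a point of the
  opposite sign in between, with two extra labels for the sign vectors without such a pair.
\<close>

section \<open>The octahedral Tucker lemma\<close>

text \<open>The orbits \<open>{x, f x}\<close> have exactly two elements and partition
  \<open>A\<close>; the induction removes one orbit at a time. Facets are cancelled in pairs this
  way below.\<close>

lemma even_card_involution:
  assumes "finite A"
    and "\<And>x. x \<in> A \<Longrightarrow> f x \<in> A" "\<And>x. x \<in> A \<Longrightarrow> f (f x) = x" "\<And>x. x \<in> A \<Longrightarrow> f x \<noteq> x"
  shows "even (card A)"
  using assms
proof (induction "card A" arbitrary: A rule: less_induct)
  case less
  show ?case
  proof (cases "A = {}")
    case False
    then obtain x where x: "x \<in> A" by auto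
    define B where "B = A - {x, f x}"
    have fx: "f x \<in> A" "f x \<noteq> x" using less.prems x by auto
    have "card {x, f x} = 2" using fx by simp
    then have c: "card A = card B + 2"
      using x fx card_Diff_subset[of "{x, f x}" A] card_mono[of A "{x, f x}"] less.prems(1)
      unfolding B_def by simp
    have "even (card B)"
    proof (rule less.hyps)
      show "card B < card A" using c by simp
      show "finite B" using less.prems(1) by (simp add: B_def)
      fix y assume y: "y \<in> B"
      then have "y \<in> A" "y \<noteq> x" "y \<noteq> f x" by (auto simp: B_def)
      then have "f y \<in> A" "f (f y) = y" "f y \<noteq> y" using less.prems by auto
      moreover from this have "f y \<noteq> x" "f y \<noteq> f x"
        using less.prems(3)[OF x] \<open>y \<noteq> x\<close> \<open>y \<noteq> f x\<close> by metis+
      ultimately show "f y \<in> B" "f (f y) = y" "f y \<noteq> y" by (auto simp: B_def)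
    qed
    then show ?thesis using c by simp
  qed simp
qed

section \<open>Label multisets with alternating signs\<close>

text \<open>
  The signs alternate when the labels are ordered by absolute value; \<open>s\<close> tells whether the first is positive.
\<close>
inductive alternating :: "bool \<Rightarrow> int multiset \<Rightarrow> bool" where
  empty: "alternating s {#}"
| add: "alternating (\<not> s) R \<Longrightarrow> (a > 0) = s \<Longrightarrow> (\<And>y. y \<in># R \<Longrightarrow> \<bar>a\<bar> < \<bar>y\<bar>) \<Longrightarrow> alternating s (add_mset a R)"

text \<open>Inversion of the rule \<open>add\<close> could split off any element. As
  \<open>a\<close> is least in absolute value and the rule demands a strict minimum, the element
  split off must be \<open>a\<close>.\<close>

lemma alternating_add_iff:
  assumes "\<And>y. y \<in># R \<Longrightarrow> \<bar>a\<bar> \<le> \<bar>y\<bar>"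
  shows "alternating s (add_mset a R) \<longleftrightarrow>
    (a > 0) = s \<and> (\<forall>y\<in>#R. \<bar>a\<bar> < \<bar>y\<bar>) \<and> alternating (\<not> s) R"
proof
  assume "alternating s (add_mset a R)"
  then show "(a > 0) = s \<and> (\<forall>y\<in>#R. \<bar>a\<bar> < \<bar>y\<bar>) \<and> alternating (\<not> s) R"
  proof cases
    case (add R' b)
    have "a = b"
    proof (rule ccontr)
      assume "a \<noteq> b"
      then have "a \<in># R'" "b \<in># R" using add(1)
        by (metis insert_noteq_member)+
      then show False using add(4) assms by fastforce
    qed
    then show ?thesis using add by auto
  qed auto
qed (auto intro: alternating.add)

text \<open>Each added element is strictly below the others in absolute value, so no absolute value
  repeats.\<close>

lemma card_abs_alternating: "alternating s A \<Longrightarrow> card (abs ` set_mset A) = size A"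
proof (induction rule: alternating.induct)
  case (add s R a)
  then have "\<bar>a\<bar> \<notin> abs ` set_mset R" by force
  then show ?case using add by simp
qed simp

text \<open>The label 0 would count as non-positive both before and after negation, so it has to be
  excluded.\<close>

lemma alternating_uminus:
  "alternating s A \<Longrightarrow> 0 \<notin># A \<Longrightarrow> alternating (\<not> s) (image_mset uminus A)"
proof (induction rule: alternating.induct)
  case (add s R a)
  have "alternating (\<not> s) (add_mset (- a) (image_mset uminus R))"
    by (rule alternating.add) (use add in auto)
  then show ?case by simp
qed (simp add: alternating.empty)

text \<open>This is the local step of Ky Fan's argument: the labels \<open>A\<close> of a simplex
  have an odd number of facets of type \<open>s\<close> exactly when \<open>A\<close> is nonempty
  and alternates. For the induction the element \<open>a\<close> of least absolute value is split
  off. If it is unique, deleting it leaves \<open>R\<close>, and any other deletion happens inside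
  \<open>R\<close> with the opposite starting sign.\<close>

lemma alternating_facets_parity:
  assumes "\<And>x y. x \<in># A \<Longrightarrow> y \<in># A \<Longrightarrow> \<bar>x\<bar> = \<bar>y\<bar> \<Longrightarrow> x = y"
  shows "even (size {#x \<in># A. alternating s (A - {#x#})#}
    + (of_bool (alternating s A) + of_bool (alternating (\<not> s) A)))"
  using assms
proof (induction "size A" arbitrary: A s rule: less_induct)
  case less
  show ?case
  proof (cases "A = {#}")
    case True
    then show ?thesis by (simp add: alternating.empty)
  next
    case False
    then obtain a where a: "a \<in># A" "\<And>y. y \<in># A \<Longrightarrow> \<bar>a\<bar> \<le> \<bar>y\<bar>"
      using ex_min_if_finite[of "abs ` set_mset A"] by (metis (no_types, lifting) finite_imageI finite_set_mset
          imageE image_eqI image_is_empty not_less set_mset_eq_empty_iff)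
    then obtain R where R: "A = add_mset a R" by (metis mset_add)
    have min: "\<bar>a\<bar> \<le> \<bar>y\<bar>" if "y \<in># R" for y using a(2) R that by auto
    show ?thesis
    proof (cases "a \<in># R")
      case True
      then obtain Q where Q: "R = add_mset a Q" by (metis mset_add)
      \<comment> \<open>A repeated label violates the strict increase of absolute values.\<close>
      have not_alt: "\<not> alternating t (add_mset a (add_mset a B))" if "B \<subseteq># Q" for B t
      proof -
        have "\<bar>a\<bar> \<le> \<bar>y\<bar>" if "y \<in># add_mset a B" for y
          using that min \<open>B \<subseteq># Q\<close> by (auto simp: Q dest: mset_subset_eqD)
        then show ?thesis using alternating_add_iff[of "add_mset a B" a t] by auto
      qed
      have "{#x \<in># Q. alternating s (A - {#x#})#} = {#}"
      proof -
        have "\<not> alternating s (A - {#x#})" if "x \<in># Q" for x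
        proof -
          have "A - {#x#} = add_mset a (add_mset a (Q - {#x#}))"
            using that by (simp add: R Q)
          then show ?thesis using not_alt[of "Q - {#x#}"] by simp
        qed
        then show ?thesis by (auto simp: filter_mset_eq_conv)
      qed
      \<comment> \<open>A deletion that keeps both copies of \<open>a\<close> is never alternating,
        and the two deletions of a copy of \<open>a\<close> give the same multiset.\<close>
      then have "size {#x \<in># A. alternating s (A - {#x#})#} = 2 * of_bool (alternating s (add_mset a Q))"
        by (simp add: R Q)
      then show ?thesis using not_alt[of Q] by (simp add: R Q)
    next
      case False
      have lt: "\<bar>a\<bar> < \<bar>y\<bar>" if "y \<in># R" for y
        using that min[OF that] less.prems[of a y] False R by force
      have A: "alternating t A \<longleftrightarrow> (a > 0) = t \<and> alternating (\<not> t) R" for t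
        using alternating_add_iff[OF min] lt by (auto simp: R)
      have F: "alternating s (A - {#x#}) \<longleftrightarrow> (a > 0) = s \<and> alternating (\<not> s) (R - {#x#})"
        if "x \<in># R" for x
      proof -
        have "A - {#x#} = add_mset a (R - {#x#})" using that by (simp add: R)
        moreover have "\<And>y. y \<in># R - {#x#} \<Longrightarrow> \<bar>a\<bar> < \<bar>y\<bar>" using lt by (meson in_diffD)
        ultimately show ?thesis using alternating_add_iff[of "R - {#x#}" a s] by force
      qed
      have "{#x \<in># R. alternating s (A - {#x#})#} =
          {#x \<in># R. (a > 0) = s \<and> alternating (\<not> s) (R - {#x#})#}"
        using F by (intro filter_mset_cong) auto
      then have "size {#x \<in># A. alternating s (A - {#x#})#} = of_bool (alternating s R)
          + (if (a > 0) = s then size {#x \<in># R. alternating (\<not> s) (R - {#x#})#} else 0)"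
        by (simp add: R)
      moreover have "even (size {#x \<in># R. alternating (\<not> s) (R - {#x#})#}
          + (of_bool (alternating (\<not> s) R) + of_bool (alternating (\<not> \<not> s) R)))"
        by (rule less.hyps) (use less.prems in \<open>auto simp: R\<close>)
      ultimately show ?thesis by (auto simp: A)
    qed
  qed
qed

section \<open>Sign vectors and their maximal chains\<close>

text \<open>
  A sign vector in \<open>{+, -, 0}\<^sup>n\<close> is the set of the signed indices of its nonzero coordinates.
  The condition \<open>X \<inter> uminus ` X = {}\<close> also excludes \<open>0\<close>.
\<close>
definition sign_vector :: "nat \<Rightarrow> int set \<Rightarrow> bool" where
  "sign_vector n X \<longleftrightarrow> X \<noteq> {} \<and> X \<subseteq> {- int n..int n} \<and> X \<inter> uminus ` X = {}"

text \<open>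
  A list encodes the maximal chain of sign vectors formed by its nonempty prefixes.
\<close>
definition signed_perms :: "nat \<Rightarrow> int list set" where
  "signed_perms d = {xs. length xs = d \<and> abs ` set xs = {1..int d}}"

lemma signed_permsD:
  assumes "xs \<in> signed_perms d"
  shows "length xs = d" "abs ` set xs = {1..int d}" "distinct (map abs xs)"
proof -
  show 1: "length xs = d" "abs ` set xs = {1..int d}" using assms by (auto simp: signed_perms_def)
  show "distinct (map abs xs)" by (rule card_distinct) (simp add: 1)
qed

lemma finite_signed_perms: "finite (signed_perms d)"
proof (rule finite_subset)
  show "signed_perms d \<subseteq> {xs. set xs \<subseteq> {- int d..int d} \<and> length xs = d}"
    by (force simp: signed_perms_def)
  show "finite {xs. set xs \<subseteq> {- int d..int d} \<and> length xs = d}"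
    by (rule finite_lists_length_eq) simp
qed

lemma signed_perms_no_opposite:
  assumes "xs \<in> signed_perms d" "x \<in> set xs"
  shows "- x \<notin> set xs"
proof
  assume "- x \<in> set xs"
  have "inj_on abs (set xs)" using signed_permsD(3)[OF assms(1)] by (simp add: distinct_map)
  then have "x = - x" using inj_onD[of abs "set xs" x "- x"] assms(2) \<open>- x \<in> set xs\<close> by simp
  moreover have "\<bar>x\<bar> \<in> {1..int d}" using assms signed_permsD(2) by blast
  ultimately show False by auto
qed

lemma sign_vector_take:
  assumes "xs \<in> signed_perms d" "d \<le> n" "j < d"
  shows "sign_vector n (set (take (Suc j) xs))"
proof -
  have sub: "set (take (Suc j) xs) \<subseteq> set xs" by (rule set_take_subset)
  have "\<bar>x\<bar> \<in> {1..int d}" if "x \<in> set xs" for x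
    using that signed_permsD(2)[OF assms(1)] by blast
  then have "set xs \<subseteq> {- int n..int n}" using assms(2) by fastforce
  moreover have "set xs \<inter> uminus ` set xs = {}"
    using signed_perms_no_opposite[OF assms(1)] by force
  moreover have "set (take (Suc j) xs) \<noteq> {}" using signed_permsD(1)[OF assms(1)] assms(3) by auto
  ultimately show ?thesis using sub unfolding sign_vector_def by blast
qed

text \<open>Index \<open>j\<close> stands for the prefix of length \<open>j + 1\<close>. With
  \<open>J = {..<d}\<close> these are the labels of a whole simplex of the barycentric subdivision;
  with \<open>{..<d} - {i}\<close> they are those of a facet.\<close>

definition chain_labels :: "(int set \<Rightarrow> int) \<Rightarrow> int list \<Rightarrow> nat set \<Rightarrow> int multiset" where
  "chain_labels lab xs J = image_mset (\<lambda>j. lab (set (take (Suc j) xs))) (mset_set J)"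

lemma chain_labels_cong:
  assumes "\<And>j. j \<in> J \<Longrightarrow> set (take (Suc j) xs) = set (take (Suc j) ys)"
  shows "chain_labels lab xs J = chain_labels lab ys J"
  unfolding chain_labels_def by (rule image_mset_cong) (use assms in \<open>cases "finite J"; auto\<close>)

text \<open>The maximal chains triangulate the boundary of the \<open>d\<close>-dimensional
  cross-polytope; these are the ones in the half where coordinate \<open>d\<close> is nonnegative,
  one from each antipodal pair.\<close>

definition hemisphere :: "nat \<Rightarrow> int list set" where
  "hemisphere d = {xs \<in> signed_perms d. int d \<in> set xs}"

section \<open>Facets shared by two maximal chains, and facets on the equator\<close>

definition swap_at :: "nat \<Rightarrow> 'a list \<Rightarrow> 'a list" where
  "swap_at i xs = xs[i := xs ! Suc i, Suc i := xs ! i]"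

text \<open>Only the prefix that ends between the two swapped positions changes as a set.\<close>

lemma set_take_swap_at:
  assumes "Suc i < length xs" "j \<noteq> i"
  shows "set (take (Suc j) (swap_at i xs)) = set (take (Suc j) xs)"
proof (cases "j < i")
  case True
  then show ?thesis by (simp add: swap_at_def)
next
  case False
  then have "take (Suc j) (swap_at i xs) = swap_at i (take (Suc j) xs)"
    using assms by (simp add: swap_at_def take_update_swap)
  moreover have "set (swap_at i (take (Suc j) xs)) = set (take (Suc j) xs)"
    unfolding swap_at_def by (rule set_swap) (use False assms in auto)
  ultimately show ?thesis by simp
qed

text \<open>A facet that omits a vertex other than the top one lies in exactly two maximal chains,
  which differ by a swap of neighbouring entries. The swap keeps the set of entries and hence the
  hemisphere.\<close>

lemma even_card_swap_facets:
  assumes "Suc i < d"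
  shows "even (card {xs \<in> hemisphere d. alternating s (chain_labels lab xs ({..<d} - {i}))})"
proof (rule even_card_involution[where f = "swap_at i"])
  show "finite {xs \<in> hemisphere d. alternating s (chain_labels lab xs ({..<d} - {i}))}"
    using finite_signed_perms by (auto simp: hemisphere_def)
  fix xs assume xs: "xs \<in> {xs \<in> hemisphere d. alternating s (chain_labels lab xs ({..<d} - {i}))}"
  then have sp: "xs \<in> signed_perms d" by (simp add: hemisphere_def)
  note D = signed_permsD[OF sp]
  have i: "Suc i < length xs" using assms D by simp
  have set: "set (swap_at i xs) = set xs" unfolding swap_at_def by (rule set_swap) (use i in auto)
  have "chain_labels lab (swap_at i xs) ({..<d} - {i}) = chain_labels lab xs ({..<d} - {i})"
    by (rule chain_labels_cong) (use set_take_swap_at[OF i] in auto)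
  moreover have "swap_at i xs \<in> hemisphere d" using xs set
    by (auto simp: hemisphere_def signed_perms_def swap_at_def)
  ultimately show "swap_at i xs \<in> {xs \<in> hemisphere d. alternating s (chain_labels lab xs ({..<d} - {i}))}"
    using xs by simp
  show "swap_at i (swap_at i xs) = xs" using i
    by (auto simp: swap_at_def list_eq_iff_nth_eq nth_list_update)
  have "xs ! i \<noteq> xs ! Suc i"
    using D(3) i nth_eq_iff_index_eq[of xs i "Suc i"] by (simp add: distinct_map)
  then show "swap_at i xs \<noteq> xs" using i
    by (metis Suc_lessD n_not_Suc_n nth_list_update_eq nth_list_update_neq swap_at_def)
qed

text \<open>Omitting the top vertex leaves the sign of the last entry free. As long as that entry is
  not the coordinate that defines the hemisphere, both signs stay inside, so these facets cancel in
  pairs.\<close>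

lemma even_card_negate_last:
  "even (card {xs \<in> hemisphere (Suc d). xs ! d \<noteq> int (Suc d) \<and>
      alternating s (chain_labels lab xs {..<d})})" (is "even (card ?A)")
proof (rule even_card_involution[where f = "\<lambda>xs. xs[d := - (xs ! d)]"])
  show "finite ?A"
    using finite_signed_perms by (auto simp: hemisphere_def)
  fix xs assume xs: "xs \<in> ?A"
  then have sp: "xs \<in> signed_perms (Suc d)" by (simp add: hemisphere_def)
  note D = signed_permsD[OF sp]
  let ?ys = "xs[d := - (xs ! d)]"
  have "map abs ?ys = map abs xs" using D(1) by (auto simp: list_eq_iff_nth_eq nth_list_update)
  then have "abs ` set ?ys = abs ` set xs" by (metis list.set_map)
  then have ysp: "?ys \<in> signed_perms (Suc d)" using D by (auto simp: signed_perms_def)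
  obtain k where k: "k < Suc d" "xs ! k = int (Suc d)"
    using xs D(1) by (auto simp: hemisphere_def in_set_conv_nth)
  then have "k \<noteq> d" using xs by auto
  then have "int (Suc d) \<in> set ?ys" using k D(1) by (metis length_list_update nth_list_update_neq nth_mem)
  moreover have "- (xs ! d) \<noteq> int (Suc d)"
    using signed_perms_no_opposite[OF sp, of "int (Suc d)"] xs D(1)
    by (metis (no_types, lifting) add.inverse_inverse hemisphere_def lessI mem_Collect_eq nth_mem)
  moreover have "chain_labels lab ?ys {..<d} = chain_labels lab xs {..<d}"
    by (rule chain_labels_cong) simp
  ultimately show "?ys \<in> ?A" using xs ysp D(1) by (simp add: hemisphere_def)
  show "?ys[d := - (?ys ! d)] = xs" using D(1) by simp
  have "xs ! d \<in> set xs" using D(1) by simp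
  then have "xs ! d \<noteq> 0" using signed_perms_no_opposite[OF sp] by fastforce
  then show "?ys \<noteq> xs" using D(1)
    by (metis equal_neg_zero lessI nth_list_update_eq)
qed

text \<open>The remaining facets lie on the equator: dropping the final entry \<open>d + 1\<close>
  identifies them with the maximal chains of the sphere one dimension lower.\<close>

lemma card_boundary_facets:
  "card {xs \<in> hemisphere (Suc d). xs ! d = int (Suc d) \<and> alternating s (chain_labels lab xs {..<d})}
    = card {ys \<in> signed_perms d. alternating s (chain_labels lab ys {..<d})}" (is "card ?A = card ?B")
proof -
  let ?f = "\<lambda>ys. ys @ [int (Suc d)]"
  have ch: "chain_labels lab (?f ys) {..<d} = chain_labels lab ys {..<d}" if "length ys = d" for ys
    by (rule chain_labels_cong) (use that in auto)
  have "?A = ?f ` ?B"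
  proof (intro equalityI subsetI)
    fix xs assume xs: "xs \<in> ?A"
    then have sp: "xs \<in> signed_perms (Suc d)" by (simp add: hemisphere_def)
    note D = signed_permsD[OF sp]
    define ys where "ys = butlast xs"
    have "xs \<noteq> []" using D(1) by auto
    moreover from this have "last xs = int (Suc d)" using D(1) xs by (simp add: last_conv_nth)
    ultimately have eq: "xs = ?f ys" unfolding ys_def by (metis append_butlast_last_id)
    have "int (Suc d) \<notin> abs ` set ys" using D(3) unfolding eq by simp
    moreover have "insert (int (Suc d)) (abs ` set ys) = {1..int (Suc d)}" using D(2) unfolding eq by simp
    ultimately have "abs ` set ys = {1..int (Suc d)} - {int (Suc d)}" by blast
    also have "\<dots> = {1..int d}" by auto
    finally have "ys \<in> signed_perms d" using D(1) by (simp add: signed_perms_def ys_def)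
    then show "xs \<in> ?f ` ?B" using xs eq ch[of ys] signed_permsD(1)[of ys d] by auto
  next
    fix xs assume "xs \<in> ?f ` ?B"
    then obtain ys where ys: "ys \<in> ?B" "xs = ?f ys" by auto
    then have "length ys = d" "abs ` set ys = {1..int d}" by (auto dest: signed_permsD)
    then show "xs \<in> ?A" using ys ch[of ys]
      by (auto simp: hemisphere_def signed_perms_def nth_append)
  qed
  moreover have "inj_on ?f ?B" by (auto simp: inj_on_def)
  ultimately show ?thesis by (simp add: card_image)
qed

section \<open>Parity of the number of alternating chains\<close>

locale octahedral_labelling =
  fixes n :: nat and lab :: "int set \<Rightarrow> int"
  assumes antipodal: "sign_vector n X \<Longrightarrow> lab (uminus ` X) = - lab X"
    and not_complementary: "sign_vector n X \<Longrightarrow> sign_vector n Y \<Longrightarrow> X \<subseteq> Y \<Longrightarrow> lab X \<noteq> - lab Y"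
begin

abbreviation labels :: "int list \<Rightarrow> nat \<Rightarrow> int multiset" where
  "labels xs d \<equiv> chain_labels lab xs {..<d}"

text \<open>Two prefixes of one list are nested, so \<open>not_complementary\<close> excludes
  opposite labels.\<close>

lemma labels_in_chain:
  assumes "xs \<in> signed_perms d" "d \<le> n" "x \<in># labels xs d" "y \<in># labels xs d" "\<bar>x\<bar> = \<bar>y\<bar>"
  shows "x = y"
proof -
  obtain i j where ij: "i < d" "j < d" "x = lab (set (take (Suc i) xs))" "y = lab (set (take (Suc j) xs))"
    using assms(3,4) by (auto simp: chain_labels_def)
  have "set (take (Suc i) xs) \<subseteq> set (take (Suc j) xs) \<or> set (take (Suc j) xs) \<subseteq> set (take (Suc i) xs)"
    by (meson nle_le set_take_subset_set_take)
  then have "x \<noteq> - y"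
    using ij sign_vector_take[OF assms(1,2)] not_complementary by (metis add.inverse_inverse)
  then show ?thesis using assms(5) by linarith
qed

text \<open>The instance \<open>Y = X\<close> of \<open>not_complementary\<close> rules out the
  label 0, which is its own negative.\<close>

lemma labels_nonzero: "xs \<in> signed_perms d \<Longrightarrow> d \<le> n \<Longrightarrow> 0 \<notin># labels xs d"
  using sign_vector_take[of xs d n] not_complementary by (force simp: chain_labels_def)

lemma labels_uminus:
  assumes "xs \<in> signed_perms d" "d \<le> n"
  shows "labels (map uminus xs) d = image_mset uminus (labels xs d)"
  unfolding chain_labels_def image_mset.compositionality
  by (rule image_mset_cong)
    (use antipodal[OF sign_vector_take[OF assms]] in \<open>auto simp: take_map o_def\<close>)

lemma facets_parity:
  assumes "xs \<in> signed_perms d" "d \<le> n"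
  shows "even (card {i. i < d \<and> alternating s (chain_labels lab xs ({..<d} - {i}))}
    + (of_bool (alternating s (labels xs d)) + of_bool (alternating (\<not> s) (labels xs d))))"
proof -
  let ?g = "\<lambda>j. lab (set (take (Suc j) xs))"
  have f: "chain_labels lab xs ({..<d} - {i}) = labels xs d - {#?g i#}" if "i < d" for i
    using that by (simp add: chain_labels_def mset_set_Diff image_mset_Diff)
  have "{#x \<in># labels xs d. alternating s (labels xs d - {#x#})#}
      = image_mset ?g (mset_set {i. i < d \<and> alternating s (chain_labels lab xs ({..<d} - {i}))})"
  proof -
    have "{#x \<in># labels xs d. alternating s (labels xs d - {#x#})#}
      = image_mset ?g {#i \<in># mset_set {..<d}. alternating s (labels xs d - {#?g i#})#}"
      by (simp add: chain_labels_def filter_mset_image_mset)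
    also have "{#i \<in># mset_set {..<d}. alternating s (labels xs d - {#?g i#})#}
      = mset_set {i. i < d \<and> alternating s (chain_labels lab xs ({..<d} - {i}))}"
      by (simp add: filter_mset_mset_set) (metis (no_types, lifting) f)
    finally show ?thesis .
  qed
  then have "card {i. i < d \<and> alternating s (chain_labels lab xs ({..<d} - {i}))}
      = size {#x \<in># labels xs d. alternating s (labels xs d - {#x#})#}" by simp
  then show ?thesis using alternating_facets_parity[of "labels xs d" s] labels_in_chain[OF assms] by simp
qed

abbreviation num_alternating :: "nat \<Rightarrow> nat" where
  "num_alternating d \<equiv> card {xs \<in> signed_perms d. alternating True (labels xs d)}"

text \<open>The antipodal map exchanges the two hemispheres and the two starting signs. Chains of
  the lower hemisphere that start positive thus correspond to chains of the upper one that start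
  negative.\<close>

lemma num_alternating_hemisphere:
  assumes "0 < d" "d \<le> n"
  shows "num_alternating d = (\<Sum>xs\<in>hemisphere d.
    of_bool (alternating True (labels xs d)) + of_bool (alternating False (labels xs d)))"
proof -
  let ?P = "{xs \<in> hemisphere d. alternating True (labels xs d)}"
  let ?N = "{xs \<in> hemisphere d. alternating False (labels xs d)}"
  let ?A = "{xs \<in> signed_perms d. alternating True (labels xs d)}"
  have neg: "map uminus xs \<in> signed_perms d" if "xs \<in> signed_perms d" for xs :: "int list"
    using that by (simp add: signed_perms_def image_image)
  have alt: "alternating (\<not> s) (labels (map uminus xs) d)"
    if "xs \<in> signed_perms d" "alternating s (labels xs d)" for xs s
    using alternating_uminus[OF that(2)] labels_nonzero labels_uminus that assms by simp
  have "?A = ?P \<union> map uminus ` ?N"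
  proof (intro equalityI subsetI)
    fix xs assume xs: "xs \<in> ?A"
    show "xs \<in> ?P \<union> map uminus ` ?N"
    proof (cases "int d \<in> set xs")
      case False
      have "int d \<in> abs ` set xs" using xs assms signed_permsD(2)[of xs d] by auto
      then have "- int d \<in> set xs" using False by (auto simp: abs_if split: if_splits)
      then have "int d \<in> set (map uminus xs)" by force
      then have "map uminus xs \<in> ?N" using xs neg[of xs] alt[of xs True] by (simp add: hemisphere_def)
      moreover have "xs = map uminus (map uminus xs)" by (simp add: o_def)
      ultimately show ?thesis by blast
    qed (use xs in \<open>simp add: hemisphere_def\<close>)
  next
    fix xs assume "xs \<in> ?P \<union> map uminus ` ?N"
    then show "xs \<in> ?A" using neg alt[of _ False] by (auto simp: hemisphere_def)
  qed
  moreover have "?P \<inter> map uminus ` ?N = {}"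
  proof -
    have False if "xs \<in> ?N" "map uminus xs \<in> ?P" for xs
    proof -
      have "int d \<in> set xs" "xs \<in> signed_perms d" "- int d \<in> set xs"
        using that by (auto simp: hemisphere_def)
      then show False using signed_perms_no_opposite by blast
    qed
    then show ?thesis by blast
  qed
  moreover have fin: "finite (hemisphere d)" using finite_signed_perms by (simp add: hemisphere_def)
  moreover have "card (map uminus ` ?N) = card ?N"
    by (rule card_image) (auto simp: inj_on_def map_injective)
  ultimately have "num_alternating d = card ?P + card ?N" by (simp add: card_Un_disjoint)
  then show ?thesis using fin by (simp add: sum.distrib Int_def)
qed

text \<open>Incidences between chains of the hemisphere and their positive alternating facets are
  counted twice. Chain by chain, the parity is that of the alternating chains on the whole sphere;
  facet by facet, only the equator contributes.\<close>

lemma num_alternating_Suc: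
  assumes "Suc d \<le> n"
  shows "even (num_alternating (Suc d) + num_alternating d)"
proof -
  let ?F = "\<lambda>xs i. alternating True (chain_labels lab xs ({..<Suc d} - {i}))"
  let ?a = "\<lambda>xs. of_bool (alternating True (labels xs (Suc d))) + of_bool (alternating False (labels xs (Suc d))) :: nat"
  have fin: "finite (hemisphere (Suc d))" using finite_signed_perms by (simp add: hemisphere_def)
  have "even (\<Sum>xs\<in>hemisphere (Suc d). card {i. i < Suc d \<and> ?F xs i} + ?a xs)"
  proof (rule dvd_sum)
    fix xs assume "xs \<in> hemisphere (Suc d)"
    then show "even (card {i. i < Suc d \<and> ?F xs i} + ?a xs)"
      using facets_parity[of xs "Suc d" True] assms by (simp add: hemisphere_def)
  qed
  then have 1: "even ((\<Sum>xs\<in>hemisphere (Suc d). card {i. i < Suc d \<and> ?F xs i}) + num_alternating (Suc d))"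
    using num_alternating_hemisphere[of "Suc d"] assms by (simp add: sum.distrib)
  have "(\<Sum>xs\<in>hemisphere (Suc d). card {i. i < Suc d \<and> ?F xs i})
      = (\<Sum>xs\<in>hemisphere (Suc d). card {i \<in> {..<Suc d}. ?F xs i})" by simp
  also have "\<dots> = (\<Sum>i<Suc d. card {xs \<in> hemisphere (Suc d). ?F xs i})"
    by (rule sum_multicount_gen) (use fin in auto)
  also have "\<dots> = (\<Sum>i<d. card {xs \<in> hemisphere (Suc d). ?F xs i}) + card {xs \<in> hemisphere (Suc d). ?F xs d}"
    by simp
  finally have 2: "(\<Sum>xs\<in>hemisphere (Suc d). card {i. i < Suc d \<and> ?F xs i}) = \<dots>" .
  have 3: "even (\<Sum>i<d. card {xs \<in> hemisphere (Suc d). ?F xs i})"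
    by (rule dvd_sum) (use even_card_swap_facets in auto)
  let ?U = "{xs \<in> hemisphere (Suc d). xs ! d \<noteq> int (Suc d) \<and> alternating True (chain_labels lab xs {..<d})}"
  let ?V = "{xs \<in> hemisphere (Suc d). xs ! d = int (Suc d) \<and> alternating True (chain_labels lab xs {..<d})}"
  \<comment> \<open>Facets omitting the top vertex are split: \<open>?U\<close> cancels by negating
    the last entry, and \<open>?V\<close> is the equator.\<close>
  have "{xs \<in> hemisphere (Suc d). ?F xs d} = ?U \<union> ?V"
    by (auto simp: lessThan_Suc)
  moreover have "card (?U \<union> ?V) = card ?U + card ?V"
    by (rule card_Un_disjoint) (use fin in auto)
  ultimately have "even (card {xs \<in> hemisphere (Suc d). ?F xs d} + num_alternating d)"
    using even_card_negate_last[of d True lab] card_boundary_facets[of d True lab] by simp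
  moreover have "even (p + q)" if "even (x + p)" "x = u + w" "even u" "even (w + q)" for p q x u w :: nat
    using that by presburger
  ultimately show ?thesis using 1 2 3 by blast
qed

text \<open>The induction starts from the single empty list, whose empty multiset of labels is
  alternating.\<close>

lemma odd_num_alternating: "d \<le> n \<Longrightarrow> odd (num_alternating d)"
proof (induction d)
  case 0
  have "{xs \<in> signed_perms 0. alternating True (labels xs 0)} = {[]}"
    by (auto simp: signed_perms_def chain_labels_def alternating.empty)
  then show ?case by simp
next
  case (Suc d)
  then show ?case using num_alternating_Suc[of d] by simp
qed

text \<open>An odd number is not 0, so some chain alternates. Its \<open>n\<close> labels are
  nonzero with distinct absolute values, all in \<open>{1..m}\<close>.\<close>

theorem dim_le_label_bound:
  assumes "\<And>X. sign_vector n X \<Longrightarrow> \<bar>lab X\<bar> \<le> int m"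
  shows "n \<le> m"
proof -
  have "{xs \<in> signed_perms n. alternating True (labels xs n)} \<noteq> {}"
    using odd_num_alternating[of n] by (metis card.empty even_zero order_refl)
  then obtain xs where xs: "xs \<in> signed_perms n" "alternating True (labels xs n)" by auto
  have "abs ` set_mset (labels xs n) \<subseteq> {1..int m}"
  proof
    fix y assume "y \<in> abs ` set_mset (labels xs n)"
    then obtain x where x: "x \<in># labels xs n" "y = \<bar>x\<bar>" by auto
    then obtain j where "j < n" "x = lab (set (take (Suc j) xs))" by (auto simp: chain_labels_def)
    then have "\<bar>x\<bar> \<le> int m" using assms[OF sign_vector_take[OF xs(1)]] by simp
    moreover have "x \<noteq> 0" using x(1) labels_nonzero[OF xs(1)] by auto
    ultimately show "y \<in> {1..int m}" using x(2) by simp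
  qed
  then have "card (abs ` set_mset (labels xs n)) \<le> card {1..int m}" by (intro card_mono) auto
  then show ?thesis using card_abs_alternating[OF xs(2)] by (simp add: chain_labels_def)
qed

end

section \<open>Colourings of pairs\<close>

definition pos :: "int set \<Rightarrow> int set" where
  "pos X = {x \<in> X. 0 < x}"

text \<open>The opposite sign in between persists when the sign vector grows, and it is what forces
  the extreme pairs of opposite classes to overlap.\<close>

definition spans :: "int set \<Rightarrow> bool" where
  "spans X \<longleftrightarrow> (\<exists>a\<in>pos X. \<exists>b\<in>pos X. \<exists>m\<in>pos (uminus ` X). a < m \<and> m < b)"

lemma uminus_uminus_image: "uminus ` uminus ` X = (X :: int set)"
  by (simp add: image_image)

lemma sign_vector_uminus: "sign_vector n X \<Longrightarrow> sign_vector n (uminus ` X)"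
  unfolding sign_vector_def uminus_uminus_image by (auto simp: Int_commute)

lemma pos_mono: "X \<subseteq> Y \<Longrightarrow> pos X \<subseteq> pos Y"
  by (auto simp: pos_def)

lemma pos_sign_vector:
  assumes "sign_vector n X"
  shows "pos X \<subseteq> {1..int n}" "finite (pos X)" "pos X \<inter> pos (uminus ` X) = {}"
    "pos X \<noteq> {} \<or> pos (uminus ` X) \<noteq> {}"
proof -
  show 1: "pos X \<subseteq> {1..int n}" using assms by (auto simp: pos_def sign_vector_def)
  then show "finite (pos X)" by (rule finite_subset) simp
  show "pos X \<inter> pos (uminus ` X) = {}" using assms by (auto simp: pos_def sign_vector_def)
  obtain x where x: "x \<in> X" using assms by (auto simp: sign_vector_def)
  moreover have "x \<noteq> 0"
  proof
    assume "x = 0"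
    then have "0 \<in> X \<inter> uminus ` X" using x by force
    then show False using assms unfolding sign_vector_def by blast
  qed
  ultimately have "x \<in> pos X \<or> - x \<in> pos (uminus ` X)" by (auto simp: pos_def)
  then show "pos X \<noteq> {} \<or> pos (uminus ` X) \<noteq> {}" by auto
qed

lemma spans_Min_Max:
  assumes "sign_vector n X" "spans X"
  obtains m where "m \<in> pos (uminus ` X)" "Min (pos X) < m" "m < Max (pos X)"
    "Min (pos X) \<in> pos X" "Max (pos X) \<in> pos X"
proof -
  note fin = pos_sign_vector(2)[OF assms(1)]
  obtain a b m where abm: "a \<in> pos X" "b \<in> pos X" "m \<in> pos (uminus ` X)" "a < m" "m < b"
    using assms(2) by (auto simp: spans_def)
  have "Min (pos X) \<le> a" "b \<le> Max (pos X)" using abm fin by auto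
  moreover have "Min (pos X) \<in> pos X" "Max (pos X) \<in> pos X" using abm fin by (auto intro: Min_in Max_in)
  ultimately show thesis using that abm by fastforce
qed

section \<open>Tucker labels from a colouring of pairs\<close>

definition colour_of :: "(int \<Rightarrow> int \<Rightarrow> nat) \<Rightarrow> int set \<Rightarrow> int" where
  "colour_of c X = int (c (Min (pos X)) (Max (pos X)))"

text \<open>
  The labels \<open>\<plusminus>1\<close> and \<open>\<plusminus>2\<close> are for sign vectors with at most one sign change.
\<close>
definition sign_label :: "(int \<Rightarrow> int \<Rightarrow> nat) \<Rightarrow> int set \<Rightarrow> int" where
  "sign_label c X =
    (if spans X \<and> (spans (uminus ` X) \<longrightarrow> colour_of c X < colour_of c (uminus ` X))
       then colour_of c X + 3
     else if spans (uminus ` X) then - (colour_of c (uminus ` X) + 3)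
     else if pos (uminus ` X) = {} then 1
     else if pos X = {} then - 1
     else if Min (pos X) < Min (pos (uminus ` X)) then 2 else - 2)"

lemma colour_of_nonneg: "0 \<le> colour_of c X"
  by (simp add: colour_of_def)

text \<open>
  Two pairs with the same colour may only be disjoint if one lies entirely to the left of the other.
\<close>
locale interval_colouring =
  fixes n :: nat and c :: "int \<Rightarrow> int \<Rightarrow> nat"
  assumes conflict: "{a, b, a', b'} \<subseteq> {1..int n} \<Longrightarrow> a < b \<Longrightarrow> a' < b' \<Longrightarrow> a < b' \<Longrightarrow> a' < b \<Longrightarrow>
    a \<noteq> a' \<Longrightarrow> b \<noteq> b' \<Longrightarrow> c a b \<noteq> c a' b'"
begin

text \<open>The negative point \<open>m\<close> between the extremes of the positive class of
  \<open>X\<close> is also negative in \<open>Y\<close>, so the two extreme intervals overlap at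
  \<open>m\<close>. The positive class of \<open>X\<close> avoids the negative class of
  \<open>Y\<close>, so the endpoints differ and \<open>conflict\<close> applies.\<close>

lemma colour_of_neq:
  assumes "sign_vector n X" "sign_vector n Y" "X \<subseteq> Y" "spans X" "spans (uminus ` Y)"
  shows "colour_of c X \<noteq> colour_of c (uminus ` Y)"
proof -
  note Y = sign_vector_uminus[OF assms(2)]
  obtain m where m: "m \<in> pos (uminus ` X)" "Min (pos X) < m" "m < Max (pos X)"
    "Min (pos X) \<in> pos X" "Max (pos X) \<in> pos X"
    using spans_Min_Max[OF assms(1,4)] by blast
  obtain m' where m': "m' \<in> pos (uminus ` uminus ` Y)" "Min (pos (uminus ` Y)) < m'" "m' < Max (pos (uminus ` Y))"
    "Min (pos (uminus ` Y)) \<in> pos (uminus ` Y)" "Max (pos (uminus ` Y)) \<in> pos (uminus ` Y)"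
    using spans_Min_Max[OF Y assms(5)] by blast
  have "pos (uminus ` X) \<subseteq> pos (uminus ` Y)" using assms(3) by (intro pos_mono) auto
  then have "m \<in> pos (uminus ` Y)" using m by auto
  then have "Min (pos (uminus ` Y)) \<le> m" "m \<le> Max (pos (uminus ` Y))"
    using pos_sign_vector(2)[OF Y] by auto
  moreover have "pos X \<inter> pos (uminus ` Y) = {}"
    using pos_mono[OF assms(3)] pos_sign_vector(3)[OF assms(2)] by blast
  ultimately have "Min (pos X) < Max (pos X)" "Min (pos (uminus ` Y)) < Max (pos (uminus ` Y))"
    "Min (pos X) < Max (pos (uminus ` Y))" "Min (pos (uminus ` Y)) < Max (pos X)"
    "Min (pos X) \<noteq> Min (pos (uminus ` Y))" "Max (pos X) \<noteq> Max (pos (uminus ` Y))"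
    using m m' by (linarith, linarith, linarith, linarith, metis disjoint_iff, metis disjoint_iff)
  moreover have "{Min (pos X), Max (pos X), Min (pos (uminus ` Y)), Max (pos (uminus ` Y))} \<subseteq> {1..int n}"
    using m(4,5) m'(4,5) pos_sign_vector(1)[OF Y] pos_sign_vector(1)[OF assms(1)] by blast
  ultimately show ?thesis using conflict unfolding colour_of_def of_nat_eq_iff by blast
qed

text \<open>If both classes span, the smaller colour decides the sign of the label; a tie is
  excluded by \<open>colour_of_neq\<close> with \<open>Y = X\<close>. Otherwise, if both classes are
  nonempty, their minima differ.\<close>

lemma sign_label_uminus:
  assumes "sign_vector n X"
  shows "sign_label c (uminus ` X) = - sign_label c X"
proof (cases "spans X \<or> spans (uminus ` X)")
  case True
  have "colour_of c X \<noteq> colour_of c (uminus ` X)" if "spans X" "spans (uminus ` X)"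
    using colour_of_neq[OF assms assms] that by simp
  then show ?thesis using True by (auto simp: sign_label_def uminus_uminus_image)
next
  case False
  have "Min (pos X) \<noteq> Min (pos (uminus ` X))" if "pos X \<noteq> {}" "pos (uminus ` X) \<noteq> {}"
    using Min_in[OF pos_sign_vector(2)[OF assms] that(1)]
      Min_in[OF pos_sign_vector(2)[OF sign_vector_uminus[OF assms]] that(2)]
      pos_sign_vector(3)[OF assms] by (metis disjoint_iff)
  then show ?thesis using False pos_sign_vector(4)[OF assms]
    by (cases "pos X = {}"; cases "pos (uminus ` X) = {}") (simp_all add: sign_label_def uminus_uminus_image)
qed

lemma sign_label_not_opposite:
  assumes X: "sign_vector n X" and Y: "sign_vector n Y" and "X \<subseteq> Y" and "0 < sign_label c X"
  shows "sign_label c Y \<noteq> - sign_label c X"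
proof
  assume eq: "sign_label c Y = - sign_label c X"
  note nonneg = colour_of_nonneg[of c X] colour_of_nonneg[of c "uminus ` X"]
    colour_of_nonneg[of c Y] colour_of_nonneg[of c "uminus ` Y"]
  have sub: "pos X \<subseteq> pos Y" "pos (uminus ` X) \<subseteq> pos (uminus ` Y)"
    using \<open>X \<subseteq> Y\<close> by (auto intro!: pos_mono)
  consider "spans X" "sign_label c X = colour_of c X + 3"
    | "sign_label c X = 1" "pos (uminus ` X) = {}"
    | "sign_label c X = 2" "pos (uminus ` X) \<noteq> {}" "pos X \<noteq> {}" "Min (pos X) < Min (pos (uminus ` X))"
    using assms(4) nonneg by (auto simp: sign_label_def split: if_splits)
  then show False
  proof cases
    case 1
    then have "spans (uminus ` Y)" "colour_of c X = colour_of c (uminus ` Y)"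
      using eq nonneg by (auto simp: sign_label_def split: if_splits)
    then show False using colour_of_neq[OF X Y \<open>X \<subseteq> Y\<close> 1(1)] by simp
  next
    case 2
    then have "pos Y = {}" using eq nonneg by (auto simp: sign_label_def split: if_splits)
    then show False using 2 sub pos_sign_vector(4)[OF X] by auto
  next
    case 3
    then have n: "\<not> spans (uminus ` Y)" "\<not> Min (pos Y) < Min (pos (uminus ` Y))"
      using eq nonneg by (auto simp: sign_label_def split: if_splits)
    note fin = pos_sign_vector(2)[OF Y] pos_sign_vector(2)[OF sign_vector_uminus[OF Y]]
      pos_sign_vector(2)[OF sign_vector_uminus[OF X]]
    have ne: "pos Y \<noteq> {}" "pos (uminus ` Y) \<noteq> {}" using 3 sub by auto
    have mem: "Min (pos Y) \<in> pos Y" "Min (pos (uminus ` Y)) \<in> pos (uminus ` Y)"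
      "Min (pos (uminus ` X)) \<in> pos (uminus ` Y)"
      using Min_in ne fin 3 sub by blast+
    have "Min (pos Y) \<noteq> Min (pos (uminus ` Y))"
      using mem pos_sign_vector(3)[OF Y] by (metis disjoint_iff)
    then have "Min (pos (uminus ` Y)) < Min (pos Y)" using n by simp
    moreover have "Min (pos Y) < Min (pos (uminus ` X))"
      using Min_antimono[OF sub(1) 3(3) fin(1)] 3 by simp
    \<comment> \<open>In \<open>Y\<close> a negative, a positive and a negative index follow each
      other, so \<open>Y\<close> would carry a colour label instead of -2.\<close>
    ultimately have "spans (uminus ` Y)" using mem by (auto simp: spans_def uminus_uminus_image)
    then show False using n by simp
  qed
qed

sublocale octahedral_labelling n "sign_label c"
proof
  fix X assume X: "sign_vector n X"
  then show "sign_label c (uminus ` X) = - sign_label c X" by (rule sign_label_uminus)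
  fix Y assume Y: "sign_vector n Y" and "X \<subseteq> Y"
  have nonzero: "sign_label c X \<noteq> 0"
    using colour_of_nonneg[of c X] colour_of_nonneg[of c "uminus ` X"] by (auto simp: sign_label_def)
  show "sign_label c X \<noteq> - sign_label c Y"
  proof (cases "0 < sign_label c X")
    case True
    then show ?thesis using sign_label_not_opposite[OF X Y \<open>X \<subseteq> Y\<close>] by simp
  next
    case False
    \<comment> \<open>Negating both sign vectors reduces to the case of a positive label.\<close>
    then have "0 < sign_label c (uminus ` X)" using nonzero sign_label_uminus[OF X] by simp
    then show ?thesis
      using sign_label_not_opposite[OF sign_vector_uminus[OF X] sign_vector_uminus[OF Y] image_mono[OF \<open>X \<subseteq> Y\<close>]]
        sign_label_uminus[OF X] sign_label_uminus[OF Y] by auto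
  qed
qed

text \<open>The colours 0 to \<open>r - 1\<close> are shifted by 3, so the absolute values of all
  labels are at most \<open>r + 2\<close>.\<close>

theorem num_colours_ge:
  assumes "0 < r" and less: "\<And>a b. 1 \<le> a \<Longrightarrow> a < b \<Longrightarrow> b \<le> int n \<Longrightarrow> c a b < r"
  shows "n \<le> r + 2"
proof (rule dim_le_label_bound)
  have col: "colour_of c X + 3 \<le> int (r + 2)" if X: "sign_vector n X" "spans X" for X
  proof -
    obtain m where "m \<in> pos (uminus ` X)" "Min (pos X) < m" "m < Max (pos X)" "Min (pos X) \<in> pos X" "Max (pos X) \<in> pos X"
      using spans_Min_Max[OF X] by blast
    then have "c (Min (pos X)) (Max (pos X)) < r"
      using pos_sign_vector(1)[OF X(1)] by (intro less) auto
    then show ?thesis by (simp add: colour_of_def)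
  qed
  fix X assume X: "sign_vector n X"
  show "\<bar>sign_label c X\<bar> \<le> int (r + 2)"
    using col[OF X] col[OF sign_vector_uminus[OF X]] \<open>0 < r\<close>
      colour_of_nonneg[of c X] colour_of_nonneg[of c "uminus ` X"]
    by (auto simp: sign_label_def)
qed

end

section \<open>Star tree rank\<close>

lemma is_min_of_star_treesE:
  assumes "is_min_of_star_trees n M r"
  obtains v :: "nat \<Rightarrow> nat \<Rightarrow> real"
  where "\<And>k i j. k < r \<Longrightarrow> i \<in> {1..n} \<Longrightarrow> j \<in> {1..n} \<Longrightarrow> i \<noteq> j \<Longrightarrow> M i j \<le> v k i + v k j"
    and "\<And>i j. i \<in> {1..n} \<Longrightarrow> j \<in> {1..n} \<Longrightarrow> i \<noteq> j \<Longrightarrow> \<exists>k<r. v k i + v k j = M i j"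
proof -
  obtain S where S: "\<forall>k<r. star_tree_matrix n (S k)"
    and M: "\<forall>i\<in>{1..n}. \<forall>j\<in>{1..n}. i \<noteq> j \<longrightarrow> M i j = Min ((\<lambda>k. S k i j) ` {..<r})"
    using assms unfolding is_min_of_star_trees_def by blast
  have "0 < r" using assms by (simp add: is_min_of_star_trees_def)
  obtain v where v: "\<And>k i j. k < r \<Longrightarrow> i \<in> {1..n} \<Longrightarrow> j \<in> {1..n} \<Longrightarrow> i \<noteq> j \<Longrightarrow> S k i j = v k i + v k j"
    using S unfolding star_tree_matrix_def by metis
  show thesis
  proof (rule that)
    fix k i j assume *: "k < r" "i \<in> {1..n}" "j \<in> {1..n}" "i \<noteq> j"
    then have "M i j \<le> S k i j" by (simp add: M)
    then show "M i j \<le> v k i + v k j" using v * by simp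
  next
    fix i j assume *: "i \<in> {1..n}" "j \<in> {1..n}" "i \<noteq> j"
    have "Min ((\<lambda>k. S k i j) ` {..<r}) \<in> (\<lambda>k. S k i j) ` {..<r}" using \<open>0 < r\<close> by (intro Min_in) auto
    then obtain k where "k < r" "M i j = S k i j" using M * by auto
    then show "\<exists>k<r. v k i + v k j = M i j" using v * by auto
  qed
qed

lemma star_trees_min_lower_bound:
  assumes min: "is_min_of_star_trees n (\<lambda>i j. real (min i j)) r"
  shows "n \<le> r + 2"
proof -
  obtain v :: "nat \<Rightarrow> nat \<Rightarrow> real"
    where le: "\<And>k i j. k < r \<Longrightarrow> i \<in> {1..n} \<Longrightarrow> j \<in> {1..n} \<Longrightarrow> i \<noteq> j \<Longrightarrow> real (min i j) \<le> v k i + v k j"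
      and ex: "\<And>i j. i \<in> {1..n} \<Longrightarrow> j \<in> {1..n} \<Longrightarrow> i \<noteq> j \<Longrightarrow> \<exists>k<r. v k i + v k j = real (min i j)"
    using is_min_of_star_treesE[OF min] by metis
  \<comment> \<open>The colour of a pair is the index of a star attaining its entry.\<close>
  obtain f where f: "\<And>i j. i \<in> {1..n} \<Longrightarrow> j \<in> {1..n} \<Longrightarrow> i \<noteq> j \<Longrightarrow>
      f i j < r \<and> v (f i j) i + v (f i j) j = real (min i j)"
    using ex by metis
  define c where "c a b = f (nat a) (nat b)" for a b
  interpret interval_colouring n c
  proof
    fix a b a' b' :: int
    assume range: "{a, b, a', b'} \<subseteq> {1..int n}"
      and order: "a < b" "a' < b'" "a < b'" "a' < b" "a \<noteq> a'" "b \<noteq> b'"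
    define i j i' j' where ij: "i = nat a" "j = nat b" "i' = nat a'" "j' = nat b'"
    have r: "i \<in> {1..n}" "j \<in> {1..n}" "i' \<in> {1..n}" "j' \<in> {1..n}" using range by (auto simp: ij)
    have o: "i < j" "i' < j'" "i < j'" "i' < j" "i \<noteq> i'" "j \<noteq> j'"
      using range order by (auto simp: ij)
    show "c a b \<noteq> c a' b'"
    proof
      assume "c a b = c a' b'"
      then have eq: "f i' j' = f i j" by (simp add: c_def ij)
      define k where "k = f i j"
      have k: "k < r" "v k i + v k j = real i" "v k i' + v k j' = real i'"
        using f[of i j] f[of i' j'] r o unfolding eq k_def by simp_all
      have "real (min i i') \<le> v k i + v k i'" "real (min j j') \<le> v k j + v k j'"
        using le k r o by auto
      \<comment> \<open>Both \<open>j\<close> and \<open>j'\<close> exceed both \<open>i\<close> and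
        \<open>i'\<close>, so \<open>min j j'\<close> exceeds the larger of \<open>i\<close> and
        \<open>i'\<close>.\<close>
      moreover have "real i + real i' < real (min i i') + real (min j j')" using o by auto
      ultimately show False using k by linarith
    qed
  qed
  show ?thesis
  proof (rule num_colours_ge)
    show "0 < r" using min by (simp add: is_min_of_star_trees_def)
    fix a b :: int assume "1 \<le> a" "a < b" "b \<le> int n"
    then have "nat a \<in> {1..n}" "nat b \<in> {1..n}" "nat a \<noteq> nat b" by auto
    then show "c a b < r" using f by (simp add: c_def)
  qed
qed

section \<open>Upper bound for every dissimilarity matrix\<close>

lemma is_min_of_star_treesI:
  fixes v :: "nat \<Rightarrow> nat \<Rightarrow> real"
  assumes "0 < r"
    and "\<And>k i j. k < r \<Longrightarrow> i \<in> {1..n} \<Longrightarrow> j \<in> {1..n} \<Longrightarrow> i \<noteq> j \<Longrightarrow> M i j \<le> v k i + v k j"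
    and "\<And>i j. i \<in> {1..n} \<Longrightarrow> j \<in> {1..n} \<Longrightarrow> i \<noteq> j \<Longrightarrow> \<exists>k<r. v k i + v k j = M i j"
  shows "is_min_of_star_trees n M r"
proof -
  have "M i j = Min ((\<lambda>k. v k i + v k j) ` {..<r})" if ij: "i \<in> {1..n}" "j \<in> {1..n}" "i \<noteq> j" for i j
  proof (rule Min_eqI[symmetric])
    obtain k where "k < r" "v k i + v k j = M i j" using assms(3)[OF ij] by blast
    then show "M i j \<in> (\<lambda>k. v k i + v k j) ` {..<r}" by force
  qed (use assms(2) ij in auto)
  moreover have "star_tree_matrix n (\<lambda>i j. v k i + v k j)" for k
    unfolding star_tree_matrix_def dissimilarity_matrix_def by (auto simp: add.commute)
  ultimately show ?thesis using assms(1) unfolding is_min_of_star_trees_def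
    by (intro conjI exI[of _ "\<lambda>k i j. v k i + v k j"]) auto
qed

text \<open>
  A star with very negative weight at \<open>i\<close> realises all entries involving \<open>i\<close>. Doing this for
  \<open>i = 4, \<dots>, n\<close> leaves the triangle \<open>{1, 2, 3}\<close>, which a single further star realises.
\<close>
lemma star_trees_upper_bound:
  assumes "3 \<le> n" and M: "dissimilarity_matrix n M"
  shows "is_min_of_star_trees n M (n - 2)"
proof -
  have sym: "M i j = M j i" if "i \<in> {1..n}" "j \<in> {1..n}" "i \<noteq> j" for i j
    using M that by (simp add: dissimilarity_matrix_def)
  define B where "B = Max ((\<lambda>(i, j). \<bar>M i j\<bar>) ` ({1..n} \<times> {1..n}))"
  have B: "\<bar>M i j\<bar> \<le> B" if "i \<in> {1..n}" "j \<in> {1..n}" for i j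
    unfolding B_def by (rule Max_ge) (use that in auto)
  \<comment> \<open>On 1, 2, 3 the weights solve the three linear equations of the triangle. The
    value \<open>3 * B\<close> elsewhere outweighs them, as they are at least
    \<open>- 3 * B / 2\<close>.\<close>
  define t :: "nat \<Rightarrow> real" where "t = (\<lambda>i. if i = 1 then (M 1 2 + M 1 3 - M 2 3) / 2
    else if i = 2 then (M 1 2 + M 2 3 - M 1 3) / 2
    else if i = 3 then (M 1 3 + M 2 3 - M 1 2) / 2 else 3 * B)"
  \<comment> \<open>At the centre \<open>k\<close> the two terms \<open>3 * B\<close> cancel and the
    entry is exact; any other sum is at least \<open>4 * B\<close>.\<close>
  define s :: "nat \<Rightarrow> nat \<Rightarrow> real" where "s = (\<lambda>k i. if i = k then - 3 * B else M k i + 3 * B)"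
  \<comment> \<open>Indices 0 to \<open>n - 4\<close> give the centres 4 to \<open>n\<close>; the
    last index \<open>n - 3\<close> is the triangle star.\<close>
  define v where "v = (\<lambda>k. if k = n - 3 then t else s (k + 4))"
  have B0: "0 \<le> B" using B[of 1 1] assms(1) by simp
  have triangle: "t i + t j = M i j" if "i \<in> {1, 2, 3}" "j \<in> {1, 2, 3}" "i \<noteq> j" for i j
    using that sym[of 1 2] sym[of 1 3] sym[of 2 3] assms(1) by (auto simp: t_def field_simps)
  have t_ge: "- (3 * B) \<le> 2 * t i" for i
    using B[of 1 2] B[of 1 3] B[of 2 3] B0 assms(1) by (auto simp: t_def)
  show ?thesis
  proof (rule is_min_of_star_treesI[where v = v])
    show "0 < n - 2" using assms(1) by simp
    fix i j assume ij: "i \<in> {1..n}" "j \<in> {1..n}" "i \<noteq> j"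
    have t_le: "M i j \<le> t i + t j"
    proof (cases "i \<in> {1, 2, 3} \<and> j \<in> {1, 2, 3}")
      case False
      then have "t i = 3 * B \<or> t j = 3 * B" by (auto simp: t_def)
      then show ?thesis using t_ge[of i] t_ge[of j] B[OF ij(1,2)] B0 by linarith
    qed (use triangle ij in simp)
    have s_le: "M i j \<le> s k i + s k j" if "k \<in> {1..n}" for k
      using B[OF ij(1,2)] B[OF that ij(1)] B[OF that ij(2)] sym[OF ij] ij(3) by (auto simp: s_def)
    show "M i j \<le> v k i + v k j" if "k < n - 2" for k
      using t_le s_le[of "k + 4"] that by (auto simp: v_def)
    have s_eq: "s i i + s i j = M i j" "s j i + s j j = M i j"
      using ij sym[OF ij] by (auto simp: s_def)
    consider "i \<in> {1, 2, 3}" "j \<in> {1, 2, 3}" | "4 \<le> i" | "4 \<le> j" using ij by force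
    then show "\<exists>k<n - 2. v k i + v k j = M i j"
    proof cases
      case 1
      then show ?thesis using triangle ij assms(1) by (intro exI[of _ "n - 3"]) (auto simp: v_def)
    next
      case 2
      then show ?thesis using s_eq ij by (intro exI[of _ "i - 4"]) (auto simp: v_def)
    next
      case 3
      then show ?thesis using s_eq ij by (intro exI[of _ "j - 4"]) (auto simp: v_def)
    qed
  qed
qed

theorem theorem4p2:
  fixes n :: nat
  assumes "n \<ge> 3"
  shows "(\<forall>M. dissimilarity_matrix n M \<longrightarrow> star_tree_rank n M \<le> enat (n - 2)) \<and>
         dissimilarity_matrix n (\<lambda>i j. real (min i j)) \<and>
         star_tree_rank n (\<lambda>i j. real (min i j)) = enat (n - 2)"
proof (intro conjI allI impI)
  have upper: "star_tree_rank n M \<le> enat (n - 2)" if "dissimilarity_matrix n M" for M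
    unfolding star_tree_rank_def using star_trees_upper_bound[OF assms that] by (auto intro: Inf_lower)
  then show "star_tree_rank n M \<le> enat (n - 2)" if "dissimilarity_matrix n M" for M
    using that .
  show min: "dissimilarity_matrix n (\<lambda>i j. real (min i j))"
    by (simp add: dissimilarity_matrix_def min.commute)
  have "enat (n - 2) \<le> star_tree_rank n (\<lambda>i j. real (min i j))"
    unfolding star_tree_rank_def by (rule Inf_greatest) (auto dest: star_trees_min_lower_bound)
  then show "star_tree_rank n (\<lambda>i j. real (min i j)) = enat (n - 2)"
    using upper[OF min] by simp
qed

end
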